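(* Let $m\in\mathbb{N}$ and let $\mathcal{X}$ be a topological vector space that is a $\sigma$-Peano space. Then the set $$\mathcal{CS}_\infty(\mathbb{R}^m,\mathcal{X})=\left\{f\in\mathcal{C}(\mathbb{R}^m,\mathcal{X}): f^{-1}(\{a\})\text{ is unbounded for every }a\in\mathcal{X}\right\}$$ is maximal lineable in $\mathcal{C}(\mathbb{R}^m,\mathcal{X})$.
   Context: $\mathcal{C}(\mathbb{R}^m,\mathcal{X})$ is the vector space of all continuous maps $\mathbb{R}^m\to\mathcal{X}$. A Peano space is a Hausdorff topological space that is a continuous image of the unit interval $[0,1]$ (equivalently, a non-empty compact, connected, locally connected, second-countable Hausdorff space). A topological space $X$ is a $\sigma$-Peano space if there is an increasing sequence of subsets $K_1\subset K_2\subset\cdots\subset X$, each of which is a Peano space with the topology inherited from $X$, such that $\bigcup_{n\in\mathbb{N}}K_n=X$. A subset $S$ of a vector space $V$ is maximal lineable in $V$ if $S\cup\{0\}$ contains a vector subspace of $V$ whose (algebraic) dimension equals $\dim(V)$. *)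

theory Defs
  imports "HOL-Analysis.Analysis" "HOL-Library.Function_Algebras" "HOL-Library.Equipollence"
begin

section \<open>Topological vector spaces\<close>

text \<open>
  The scalar field is any \<^class>\<open>real_normed_field\<close>.  By the Gelfand--Mazur theorem such a field
  is (isometrically) the reals or the complex numbers, so this covers exactly the real and the
  complex topological vector spaces.  No separation axiom is imposed.
\<close>

locale topological_vector_space = vector_space scl
  for scl :: "'k::real_normed_field \<Rightarrow> 'x::topological_ab_group_add \<Rightarrow> 'x" +
  assumes continuous_scl: "continuous_on UNIV (\<lambda>(c, x). scl c x)"

section \<open>Peano spaces\<close>

definition Peano_space :: "'a topology \<Rightarrow> bool" where
  "Peano_space T \<longleftrightarrow>
     Hausdorff_space T \<and>
     (\<exists>g. continuous_map (top_of_set {0..1::real}) T g \<and> g ` {0..1} = topspace T)"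

definition sigma_Peano_space :: "'a topology \<Rightarrow> bool" where
  "sigma_Peano_space T \<longleftrightarrow>
     (\<exists>K :: nat \<Rightarrow> 'a set.
        incseq K \<and>
        (\<forall>n. K n \<subseteq> topspace T \<and> Peano_space (subtopology T (K n))) \<and>
        (\<Union>n. K n) = topspace T)"

section \<open>Maximal lineability\<close>

text \<open>
  The following notions are meant for a \<open>scl\<close> with \<^term>\<open>vector_space scl\<close>.
  The algebraic dimension may be infinite, so it is compared through the cardinalities of Hamel
  bases (the library's \<open>vector_space.dim\<close> is a natural number and collapses infinite dimensions).
  Every subspace has a basis and any two bases of it are equipollent, so it does not
  matter which bases are chosen.
\<close>

definition same_dimension :: "('k::field \<Rightarrow> 'v::ab_group_add \<Rightarrow> 'v) \<Rightarrow> 'v set \<Rightarrow> 'v set \<Rightarrow> bool" where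
  "same_dimension scl V W \<longleftrightarrow>
     (\<exists>B C. \<not> module.dependent scl B \<and> module.span scl B = V \<and>
            \<not> module.dependent scl C \<and> module.span scl C = W \<and> B \<approx> C)"

definition maximal_lineable :: "('k::field \<Rightarrow> 'v::ab_group_add \<Rightarrow> 'v) \<Rightarrow> 'v set \<Rightarrow> 'v set \<Rightarrow> bool" where
  "maximal_lineable scl S V \<longleftrightarrow>
     S \<subseteq> V \<and> (\<exists>W. module.subspace scl W \<and> W \<subseteq> S \<union> {0} \<and> same_dimension scl W V)"

section \<open>Spaces of continuous maps\<close>

definition fun_scale :: "('k \<Rightarrow> 'x \<Rightarrow> 'x) \<Rightarrow> 'k \<Rightarrow> ('a \<Rightarrow> 'x) \<Rightarrow> 'a \<Rightarrow> 'x" where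
  "fun_scale scl c f = (\<lambda>t. scl c (f t))"

definition continuous_maps :: "('a::topological_space \<Rightarrow> 'x::topological_space) set" where
  "continuous_maps = {f. continuous_on UNIV f}"

definition CS_infinity :: "(real ^ 'm \<Rightarrow> 'x::topological_space) set" where
  "CS_infinity = {f \<in> continuous_maps. \<forall>a. \<not> bounded (f -` {a})}"

lemma vector_space_fun_scale:
  assumes "vector_space scl"
  shows "vector_space (fun_scale scl)"
proof -
  interpret vector_space scl by fact
  show ?thesis
    by unfold_locales (auto simp: fun_scale_def fun_eq_iff scale_right_distrib scale_left_distrib)
qed

lemma (in topological_vector_space) subspace_continuous_maps:
  "module.subspace (fun_scale scl) (continuous_maps :: ('a::topological_space \<Rightarrow> 'x) set)"
proof -
  interpret F: vector_space "fun_scale scl :: 'k \<Rightarrow> ('a \<Rightarrow> 'x) \<Rightarrow> 'a \<Rightarrow> 'x"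
    by (rule vector_space_fun_scale) (rule vector_space_axioms)
  have "continuous_on UNIV (fun_scale scl c f)" if "continuous_on UNIV f"
    for c and f :: "'a \<Rightarrow> 'x"
  proof -
    have "continuous_on UNIV (\<lambda>t. (c, f t))"
      using that by (intro continuous_intros)
    from continuous_on_compose2[OF continuous_scl this]
    show ?thesis by (simp add: fun_scale_def)
  qed
  then show ?thesis
    unfolding F.subspace_def continuous_maps_def
    by (auto simp: plus_fun_def zero_fun_def intro!: continuous_intros)
qed

end

theory Submission
  imports Defs
begin

text \<open>
  Why the theorem holds.  Assume \<open>X \<noteq> 0\<close>; otherwise every map is zero and there is nothing to do.

  \<^emph>\<open>Many functions.\<close>  A Peano curve onto \<open>K n\<close> can be damped to zero on both sides by a scalar
  factor, which yields a continuous bump \<open>\<real> \<rightarrow> X\<close> that covers \<open>K n\<close> on the block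
  \<open>[3n+1, 3n+2]\<close> and vanishes off \<open>(3n, 3n+3)\<close>.  A set \<open>A\<close> of naturals selects some of these bumps;
  their sum, evaluated at \<open>norm x\<close>, is a continuous map on \<open>\<real>\<^sup>m\<close>.  Now let \<open>A\<close> run through a family of
  continuum many infinite sets that pairwise have finite intersection.  In a linear combination of
  finitely many of the resulting maps with nonzero coefficients, choose one summand, with
  coefficient \<open>c\<close> and set \<open>A\<close>.  On the block of every sufficiently large \<open>n \<in> A\<close> all other summands
  vanish, so the combination covers \<open>c K n\<close> there.  As the sets \<open>c K n\<close> increase to \<open>X\<close>, each point
  of \<open>X\<close> is attained on infinitely many blocks.  So all these combinations have unbounded fibres; in
  particular none of them is zero, and the maps form a basis of a subspace of the required kind
  (\<open>sum_bump_series_attains_everything_far_out\<close>, \<open>independent_if_combinations_in\<close>).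

  \<^emph>\<open>No more than that.\<close>  A \<open>\<sigma>\<close>-Peano space has at most continuum many points, and a topological group
  exhausted by an increasing sequence of Hausdorff subspaces is Hausdorff.  A continuous map on
  \<open>\<real>\<^sup>m\<close> is then determined by its values on a countable dense set, so there are at most continuum
  many continuous maps (\<open>continuous_maps_lepoll_nat_sets\<close>).  Hence a basis of the space of all
  continuous maps is neither larger nor smaller than the one constructed above.
\<close>

section \<open>An almost disjoint family of sets of naturals\<close>

text \<open>The set of codes of all finite initial segments of a set of naturals, each tagged by its
  length.  Two distinct sets share only the initial segments below the first point at which they
  differ.\<close>

definition prefix_codes :: "nat set \<Rightarrow> nat set" where
  "prefix_codes S = range (\<lambda>n. prod_encode (n, set_encode (S \<inter> {..<n})))"

lemma infinite_prefix_codes: "infinite (prefix_codes S)"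
  unfolding prefix_codes_def by (rule range_inj_infinite) (auto simp: inj_on_def)

lemma finite_prefix_codes_Int:
  assumes "S \<noteq> S'"
  shows "finite (prefix_codes S \<inter> prefix_codes S')"
proof -
  obtain k where k: "(k \<in> S) \<noteq> (k \<in> S')"
    using assms by blast
  have "prefix_codes S \<inter> prefix_codes S'
          \<subseteq> (\<lambda>n. prod_encode (n, set_encode (S \<inter> {..<n}))) ` {..k}"
  proof
    fix x assume "x \<in> prefix_codes S \<inter> prefix_codes S'"
    then obtain n where x: "x = prod_encode (n, set_encode (S \<inter> {..<n}))"
      and eq: "set_encode (S \<inter> {..<n}) = set_encode (S' \<inter> {..<n})"
      unfolding prefix_codes_def by auto
    from eq have "S \<inter> {..<n} = S' \<inter> {..<n}"
      by (simp add: set_encode_eq)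
    with k have "n \<le> k"
      by (metis IntE IntI lessThan_iff not_le_imp_less)
    with x show "x \<in> (\<lambda>n. prod_encode (n, set_encode (S \<inter> {..<n}))) ` {..k}"
      by blast
  qed
  then show ?thesis
    by (rule finite_subset) simp
qed

section \<open>Counting continuous maps\<close>

text \<open>Points \<open>x \<noteq> y\<close> are separated by an open \<open>U\<close> that contains \<open>x\<close> but not \<open>y\<close>: if \<open>a\<close> is near \<open>x\<close>
  and \<open>b\<close> is near \<open>y\<close>, then \<open>y + (a - b)\<close> lies in \<open>U\<close>, and so \<open>a \<noteq> b\<close>.\<close>

lemma Hausdorff_space_topological_group:
  assumes T1: "\<And>x y :: 'x::topological_ab_group_add. x \<noteq> y \<Longrightarrow> \<exists>U. open U \<and> x \<in> U \<and> y \<notin> U"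
  shows "Hausdorff_space (euclidean :: 'x topology)"
  unfolding Hausdorff_space_def
proof (intro allI impI)
  fix x y :: 'x
  assume "x \<in> topspace euclidean \<and> y \<in> topspace euclidean \<and> x \<noteq> y"
  then obtain U where U: "open U" "x \<in> U" "y \<notin> U"
    using T1 by blast
  let ?g = "\<lambda>p. y + (fst p - snd p)"
  have "open (?g -` U)"
    by (rule open_vimage[OF U(1)]) (intro continuous_intros)
  moreover have "(x, y) \<in> ?g -` U"
    using U by simp
  ultimately obtain V V' where V: "open V" "open V'" "(x, y) \<in> V \<times> V'" "V \<times> V' \<subseteq> ?g -` U"
    by (rule open_prod_elim)
  have "disjnt V V'"
    unfolding disjnt_iff
  proof (intro allI notI)
    fix a assume "a \<in> V \<and> a \<in> V'"
    then have "?g (a, a) \<in> U"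
      using V(4) by blast
    with U show False by simp
  qed
  with V show "\<exists>U V. openin euclidean U \<and> openin euclidean V \<and> x \<in> U \<and> y \<in> V \<and> disjnt U V"
    by auto
qed

text \<open>Any two points lie in a common Hausdorff \<open>K n\<close>, whose open sets are traces of open sets of
  the group.\<close>

lemma Hausdorff_space_sigma_Peano_group:
  assumes "sigma_Peano_space (euclidean :: 'x::topological_ab_group_add topology)"
  shows "Hausdorff_space (euclidean :: 'x topology)"
proof (rule Hausdorff_space_topological_group)
  fix x y :: 'x assume "x \<noteq> y"
  obtain K :: "nat \<Rightarrow> 'x set" where K: "incseq K" "\<And>n. Peano_space (top_of_set (K n))"
      "(\<Union>n. K n) = UNIV"
    using assms unfolding sigma_Peano_space_def by auto
  obtain i j where "x \<in> K i" "y \<in> K j"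
    using K(3) by blast
  then have xy: "x \<in> K (max i j)" "y \<in> K (max i j)"
    using K(1) by (meson incseqD max.cobounded1 max.cobounded2 subsetD)+
  have "Hausdorff_space (top_of_set (K (max i j)))"
    using K(2) by (simp add: Peano_space_def)
  then obtain U V where "openin (top_of_set (K (max i j))) U" "x \<in> U" "y \<in> V" "disjnt U V"
    using xy \<open>x \<noteq> y\<close> unfolding Hausdorff_space_def by (metis topspace_euclidean_subtopology)
  then show "\<exists>U. open U \<and> x \<in> U \<and> y \<notin> U"
    using xy unfolding openin_open disjnt_iff by blast
qed

lemma sigma_Peano_space_lepoll_real:
  fixes T :: "'a topology"
  assumes "sigma_Peano_space T"
  shows "topspace T \<lesssim> (UNIV :: real set)"
proof -
  obtain K :: "nat \<Rightarrow> 'a set" where KT: "\<And>n. K n \<subseteq> topspace T"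
    and KP: "\<And>n. Peano_space (subtopology T (K n))"
    and KU: "(\<Union>n. K n) = topspace T"
    using assms unfolding sigma_Peano_space_def by auto
  have "\<exists>g. g ` {0..1::real} = K n" for n
    using KP[of n] KT[of n] unfolding Peano_space_def
    by (auto simp: topspace_subtopology_subset)
  then obtain g where g: "\<And>n. g n ` {0..1::real} = K n"
    by metis
  have "\<exists>n t. 0 \<le> t \<and> t \<le> 1 \<and> g n t = x" if x: "x \<in> topspace T" for x
  proof -
    obtain n where "x \<in> K n"
      using x KU by blast
    then have "x \<in> g n ` {0..1}"
      by (simp add: g)
    then show ?thesis
      by (metis atLeastAtMost_iff imageE)
  qed
  then obtain n t where nt: "\<And>x. x \<in> topspace T \<Longrightarrow> 0 \<le> t x \<and> t x \<le> 1 \<and> g (n x) (t x) = x"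
    by metis
  \<comment> \<open>The intervals \<open>[2n, 2n+1]\<close> are pairwise disjoint, so the sum below determines both parameters.\<close>
  have "inj_on (\<lambda>x. 2 * real (n x) + t x) (topspace T)"
  proof (rule inj_onI)
    fix x y assume xy: "x \<in> topspace T" "y \<in> topspace T"
      and eq: "2 * real (n x) + t x = 2 * real (n y) + t y"
    have "n x = n y"
      using nt[OF xy(1)] nt[OF xy(2)] eq by linarith
    with eq nt xy show "x = y"
      by (metis add_left_cancel)
  qed
  then show ?thesis
    unfolding lepoll_def by blast
qed

text \<open>Continuous maps into a Hausdorff space are determined by their values on a countable dense
  set, and a sequence of sets of naturals can be coded by one set of pairs.\<close>

lemma continuous_maps_lepoll_nat_sets:
  assumes haus: "Hausdorff_space (euclidean :: 'x::topological_space topology)"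
    and card: "(UNIV :: 'x set) \<lesssim> (UNIV :: nat set set)"
  shows "(continuous_maps :: ('a::second_countable_topology \<Rightarrow> 'x) set) \<lesssim> (UNIV :: nat set set)"
proof -
  obtain D :: "'a set" where D: "countable D" "\<And>U. open U \<Longrightarrow> U \<noteq> {} \<Longrightarrow> \<exists>d\<in>D. d \<in> U"
    using countable_dense_setE by blast
  have "D \<noteq> {}"
    using D(2)[of UNIV] by auto
  define d where "d = from_nat_into D"
  have d: "range d = D"
    unfolding d_def using \<open>D \<noteq> {}\<close> D(1) by (rule range_from_nat_into)
  obtain e :: "'x \<Rightarrow> nat set" where e: "inj e"
    using card unfolding lepoll_def by blast
  define code :: "('a \<Rightarrow> 'x) \<Rightarrow> nat set"
    where "code f = {prod_encode (n, k) |n k. k \<in> e (f (d n))}" for f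
  have "inj_on code continuous_maps"
  proof (rule inj_onI)
    fix f h :: "'a \<Rightarrow> 'x"
    assume cont: "f \<in> continuous_maps" "h \<in> continuous_maps" and eq: "code f = code h"
    have mem: "k \<in> e (q (d n)) \<longleftrightarrow> prod_encode (n, k) \<in> code q" for k n q
      by (auto simp: code_def)
    have "e (f (d n)) = e (h (d n))" for n
      using eq mem by blast
    then have on_D: "f z = h z" if "z \<in> D" for z
      using that d e by (metis imageE inj_eq)
    have dense: "z \<in> euclidean closure_of D" for z
      unfolding in_closure_of using D(2) by auto
    have "continuous_map euclidean euclidean f" "continuous_map euclidean euclidean h"
      using cont by (simp_all add: continuous_maps_def)
    then show "f = h"
      by (intro ext forall_in_closure_of_eq[OF dense haus _ _ on_D])
  qed
  then show ?thesis
    unfolding lepoll_def by blast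
qed

section \<open>Linear combinations and dimension\<close>

lemma sum_fun_apply: "(\<Sum>i\<in>I. f i) x = (\<Sum>i\<in>I. f i x)"
  by (induction I rule: infinite_finite_induct) auto

text \<open>Injectivity has the same source as independence: if \<open>\<phi> i = \<phi> j\<close> with \<open>i \<noteq> j\<close>, then the
  combination with coefficients \<open>1\<close> and \<open>-1\<close> would be zero.\<close>

lemma (in vector_space) independent_if_combinations_in:
  assumes comb: "\<And>T c. finite T \<Longrightarrow> T \<noteq> {} \<Longrightarrow> (\<And>i. i \<in> T \<Longrightarrow> c i \<noteq> 0) \<Longrightarrow>
      (\<Sum>i\<in>T. scale (c i) (\<phi> i)) \<in> S"
    and "0 \<notin> S"
  shows "inj \<phi>" and "independent (range \<phi>)" and "span (range \<phi>) \<subseteq> S \<union> {0}"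
proof -
  show inj: "inj \<phi>"
  proof (rule injI, rule ccontr)
    fix i j assume eq: "\<phi> i = \<phi> j" and "i \<noteq> j"
    then have "(\<Sum>k\<in>{i, j}. scale (if k = i then 1 else -1) (\<phi> k)) = 0"
      by simp
    moreover have "(\<Sum>k\<in>{i, j}. scale (if k = i then 1 else -1) (\<phi> k)) \<in> S"
      by (rule comb) auto
    ultimately show False
      using \<open>0 \<notin> S\<close> by simp
  qed
  have key: "(\<Sum>v\<in>t. scale (r v) v) \<in> S"
    if t: "finite t" "t \<subseteq> range \<phi>" and nz: "v \<in> t" "r v \<noteq> 0" for t r v
  proof -
    obtain T where T: "finite T" "t = \<phi> ` T"
      using finite_subset_image[OF t] by blast
    define T' where "T' = {i \<in> T. r (\<phi> i) \<noteq> 0}"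
    have "(\<Sum>v\<in>t. scale (r v) v) = (\<Sum>i\<in>T. scale (r (\<phi> i)) (\<phi> i))"
      unfolding T(2) using inj by (subst sum.reindex) (auto intro: inj_on_subset)
    also have "\<dots> = (\<Sum>i\<in>T'. scale (r (\<phi> i)) (\<phi> i))"
      unfolding T'_def using T(1) by (intro sum.mono_neutral_right) auto
    also have "\<dots> \<in> S"
      using T nz by (intro comb) (auto simp: T'_def)
    finally show ?thesis .
  qed
  show "independent (range \<phi>)"
    unfolding dependent_explicit using key \<open>0 \<notin> S\<close> by metis
  show "span (range \<phi>) \<subseteq> S \<union> {0}"
  proof
    fix y assume "y \<in> span (range \<phi>)"
    then obtain t r where y: "finite t" "t \<subseteq> range \<phi>" "y = (\<Sum>v\<in>t. scale (r v) v)"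
      unfolding span_explicit by blast
    show "y \<in> S \<union> {0}"
    proof (cases "\<exists>v\<in>t. r v \<noteq> 0")
      case True
      with key y show ?thesis by blast
    next
      case False
      with y show ?thesis by simp
    qed
  qed
qed

text \<open>An independent set that is at least as large as the whole space spans a subspace of full
  dimension: extend it to a basis of the space and apply Schroeder-Bernstein.\<close>

lemma same_dimension_if_lepoll:
  assumes "vector_space scl"
    and V: "module.subspace scl V" and B: "\<not> module.dependent scl B" "B \<subseteq> V" and le: "V \<lesssim> B"
  shows "same_dimension scl (module.span scl B) V"
proof -
  interpret vector_space scl by fact
  obtain C where C: "B \<subseteq> C" "C \<subseteq> V" "independent C" "V \<subseteq> span C"
    using maximal_independent_subset_extend[OF B(2,1)] .
  have "span C = V"
    using C V span_minimal by blast
  moreover have "B \<approx> C"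
    using C(1,2) le by (meson lepoll_antisym lepoll_trans subset_imp_lepoll)
  ultimately show ?thesis
    unfolding same_dimension_def using B C by blast
qed

section \<open>Sums of bumps\<close>

definition unit_clamp :: "real \<Rightarrow> real" where
  "unit_clamp s = max 0 (min 1 s)"

text \<open>The curve \<open>g\<close> moved from \<open>[0, 1]\<close> to the block \<open>[3n+1, 3n+2]\<close>, continued constantly beyond the
  ends, and damped to zero within distance 1 of the block.\<close>

definition bump :: "('k::real_normed_field \<Rightarrow> 'x \<Rightarrow> 'x) \<Rightarrow> (real \<Rightarrow> 'x) \<Rightarrow> nat \<Rightarrow> real \<Rightarrow> 'x" where
  "bump scl g n t = (let s = t - (3 * real n + 1) in
     scl (of_real (max 0 (1 - \<bar>s - unit_clamp s\<bar>))) (g (unit_clamp s)))"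

text \<open>The bumps with index at least \<open>t\<close> vanish at \<open>t\<close>, so the finite sum below is the sum over all
  of \<open>A\<close>.\<close>

definition bump_series ::
    "('k::real_normed_field \<Rightarrow> 'x::ab_group_add \<Rightarrow> 'x) \<Rightarrow> (nat \<Rightarrow> real \<Rightarrow> 'x) \<Rightarrow> nat set \<Rightarrow> real \<Rightarrow> 'x" where
  "bump_series scl g A t = (\<Sum>n \<in> A \<inter> {..<nat \<lceil>t\<rceil>}. bump scl (g n) n t)"

context topological_vector_space
begin

lemma bump_eq_0:
  assumes "t \<le> 3 * real n \<or> 3 * real n + 3 \<le> t"
  shows "bump scl g n t = 0"
proof -
  have "max 0 (1 - \<bar>s - unit_clamp s\<bar>) = 0" if "s = t - (3 * real n + 1)" for s
    using assms that unfolding unit_clamp_def by (auto simp: max_def min_def)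
  then show ?thesis
    by (simp add: bump_def Let_def)
qed

lemma bump_on_block:
  assumes "0 \<le> s" "s \<le> 1"
  shows "bump scl g n (3 * real n + 1 + s) = g s"
  using assms by (simp add: bump_def unit_clamp_def)

lemma continuous_on_bump:
  assumes "continuous_on {0..1} g"
  shows "continuous_on UNIV (bump scl g n)"
proof -
  have clamp: "continuous_on UNIV (\<lambda>t. unit_clamp (t - (3 * real n + 1)))"
    unfolding unit_clamp_def by (intro continuous_intros)
  have "continuous_on UNIV (\<lambda>t. g (unit_clamp (t - (3 * real n + 1))))"
    by (rule continuous_on_compose2[OF assms clamp]) (auto simp: unit_clamp_def)
  then have "continuous_on UNIV (\<lambda>t.
      (of_real (max 0 (1 - \<bar>t - (3 * real n + 1) - unit_clamp (t - (3 * real n + 1))\<bar>)) :: 'k,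
       g (unit_clamp (t - (3 * real n + 1)))))"
    by (intro continuous_intros clamp)
  from continuous_on_compose2[OF continuous_scl this]
  show ?thesis
    by (simp add: bump_def[abs_def] Let_def)
qed

lemma bump_series_eq_sum:
  assumes "t \<le> real N"
  shows "bump_series scl g A t = (\<Sum>n \<in> A \<inter> {..<N}. bump scl (g n) n t)"
  unfolding bump_series_def
proof (rule sum.mono_neutral_left)
  have "nat \<lceil>t\<rceil> \<le> N"
    using assms by (simp add: nat_le_iff ceiling_le_iff)
  then show "A \<inter> {..<nat \<lceil>t\<rceil>} \<subseteq> A \<inter> {..<N}"
    by (intro Int_mono order_refl) (simp only: lessThan_subset_iff)
  show "\<forall>n \<in> A \<inter> {..<N} - A \<inter> {..<nat \<lceil>t\<rceil>}. bump scl (g n) n t = 0"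
  proof
    fix n assume "n \<in> A \<inter> {..<N} - A \<inter> {..<nat \<lceil>t\<rceil>}"
    then have "t \<le> real n"
      by (auto simp: ceiling_le_iff nat_le_iff not_less)
    then show "bump scl (g n) n t = 0"
      by (intro bump_eq_0) simp
  qed
qed simp

lemma continuous_on_bump_series:
  assumes "\<And>n. continuous_on {0..1} (g n)"
  shows "continuous_on UNIV (bump_series scl g A)"
proof -
  have "continuous_on (\<Union>N. {..<real N}) (bump_series scl g A)"
  proof (rule continuous_on_open_UN)
    fix N :: nat
    have "continuous_on {..<real N} (\<lambda>t. \<Sum>n \<in> A \<inter> {..<N}. bump scl (g n) n t)"
      by (intro continuous_on_sum continuous_on_subset[OF continuous_on_bump] assms subset_UNIV)
    then show "continuous_on {..<real N} (bump_series scl g A)"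
      by (rule continuous_on_eq) (auto intro: bump_series_eq_sum[symmetric])
  qed simp
  moreover have "(\<Union>N. {..<real N}) = UNIV"
    using reals_Archimedean2 by auto
  ultimately show ?thesis by simp
qed

lemma bump_series_on_block:
  assumes "0 \<le> s" "s \<le> 1"
  shows "bump_series scl g A (3 * real n + 1 + s) = (if n \<in> A then g n s else 0)"
proof -
  let ?t = "3 * real n + 1 + s"
  have "bump scl (g k) k ?t = 0" if "k \<noteq> n" for k
  proof (rule bump_eq_0)
    have "k + 1 \<le> n \<or> n + 1 \<le> k"
      using that by linarith
    then have "real k + 1 \<le> real n \<or> real n + 1 \<le> real k"
      by linarith
    then show "?t \<le> 3 * real k \<or> 3 * real k + 3 \<le> ?t"
      using assms by linarith
  qed
  then have *: "bump scl (g k) k ?t = (if k = n then g n s else 0)" for k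
    using bump_on_block assms by auto
  have "bump_series scl g A ?t = (\<Sum>k \<in> A \<inter> {..<3 * n + 2}. bump scl (g k) k ?t)"
    using assms by (intro bump_series_eq_sum) simp
  also have "\<dots> = (\<Sum>k \<in> A \<inter> {..<3 * n + 2}. if k = n then g n s else 0)"
    by (simp only: *)
  also have "\<dots> = (if n \<in> A then g n s else 0)"
    by (simp add: sum.delta)
  finally show ?thesis .
qed

text \<open>One summand is singled out.  Beyond the finitely many indices that its set shares with the sets
  of the others, it is alone on its blocks.\<close>

lemma sum_bump_series_attains_everything_far_out:
  assumes K: "incseq K" "(\<Union>n. K n) = UNIV" and g: "\<And>n. g n ` {0..1} = K n"
    and A: "\<And>i. infinite (A i)" "\<And>i j. i \<noteq> j \<Longrightarrow> finite (A i \<inter> A j)"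
    and T: "finite T" "T \<noteq> {}" "\<And>i. i \<in> T \<Longrightarrow> c i \<noteq> 0"
  shows "\<exists>t \<ge> r. (\<Sum>i\<in>T. scl (c i) (bump_series scl g (A i) t)) = a"
proof -
  obtain j where j: "j \<in> T"
    using T by blast
  obtain m where m: "scl (inverse (c j)) a \<in> K m"
    using K(2) by blast
  have "finite (\<Union>i \<in> T - {j}. A j \<inter> A i)"
    using A(2) T(1) by (intro finite_UN_I) auto
  then have "infinite (A j - (\<Union>i \<in> T - {j}. A j \<inter> A i))"
    using A(1) by simp
  then obtain n where n: "n > max m (nat \<lceil>r\<rceil>)" "n \<in> A j - (\<Union>i \<in> T - {j}. A j \<inter> A i)"
    unfolding infinite_nat_iff_unbounded by blast
  have "scl (inverse (c j)) a \<in> K n"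
    using m n(1) incseqD[OF K(1), of m n] by auto
  then obtain s where s: "0 \<le> s" "s \<le> 1" "g n s = scl (inverse (c j)) a"
    unfolding g[of n, symmetric] by (auto simp del: g)
  let ?t = "3 * real n + 1 + s"
  have "(\<Sum>i\<in>T. scl (c i) (bump_series scl g (A i) ?t))
          = (\<Sum>i\<in>T. if i = j then scl (c j) (g n s) else 0)"
    using n(2) s(1,2) by (intro sum.cong) (auto simp: bump_series_on_block)
  also have "\<dots> = a"
    using T j s by simp
  finally have "(\<Sum>i\<in>T. scl (c i) (bump_series scl g (A i) ?t)) = a" .
  moreover have "r \<le> ?t"
    using n(1) s(1) by linarith
  ultimately show ?thesis by blast
qed

end

section \<open>Maximal lineability\<close>

lemma CS_infinity_norm:
  fixes f :: "real \<Rightarrow> 'x::topological_space"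
  assumes cont: "continuous_on UNIV f" and far: "\<And>a r. \<exists>t \<ge> r. f t = a"
  shows "(\<lambda>x :: real ^ 'm. f (norm x)) \<in> CS_infinity"
  unfolding CS_infinity_def continuous_maps_def
proof (intro CollectI conjI allI notI)
  show "continuous_on UNIV (\<lambda>x :: real ^ 'm. f (norm x))"
    by (rule continuous_on_compose2[OF cont continuous_on_norm_id subset_UNIV])
  fix a assume "bounded ((\<lambda>x :: real ^ 'm. f (norm x)) -` {a})"
  then obtain r where r: "\<And>x :: real ^ 'm. f (norm x) = a \<Longrightarrow> norm x \<le> r"
    unfolding bounded_iff by auto
  obtain t where t: "t \<ge> max 0 (r + 1)" "f t = a"
    using far by blast
  \<comment> \<open>Any coordinate axis will do.\<close>
  have "norm (axis undefined t :: real ^ 'm) = t"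
    using t(1) by (simp add: norm_eq_sqrt_inner inner_axis_axis)
  with r t show False
    by (metis add_le_same_cancel1 max.bounded_iff not_one_le_zero order_trans)
qed

theorem theorem3p6:
  fixes scl :: "'k::real_normed_field \<Rightarrow> 'x::topological_ab_group_add \<Rightarrow> 'x"
  assumes "topological_vector_space scl"
    and "sigma_Peano_space (euclidean :: 'x topology)"
  shows "maximal_lineable (fun_scale scl)
           (CS_infinity :: (real ^ 'm \<Rightarrow> 'x) set)
           (continuous_maps :: (real ^ 'm \<Rightarrow> 'x) set)"
proof -
  interpret X: topological_vector_space scl by fact
  have vs: "vector_space (fun_scale scl :: 'k \<Rightarrow> (real ^ 'm \<Rightarrow> 'x) \<Rightarrow> _)"
    by (rule vector_space_fun_scale) (rule X.vector_space_axioms)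
  then interpret F: vector_space "fun_scale scl :: 'k \<Rightarrow> (real ^ 'm \<Rightarrow> 'x) \<Rightarrow> _" .
  let ?C = "continuous_maps :: (real ^ 'm \<Rightarrow> 'x) set"
  let ?S = "CS_infinity :: (real ^ 'm \<Rightarrow> 'x) set"
  have sub: "?S \<subseteq> ?C"
    unfolding CS_infinity_def by blast
  have subspace: "F.subspace ?C"
    by (rule X.subspace_continuous_maps)
  show ?thesis
  proof (cases "\<exists>a :: 'x. a \<noteq> 0")
    case False
    then have trivial: "a = b" for a b :: 'x
      by metis
    have "f = 0" for f :: "real ^ 'm \<Rightarrow> 'x"
      by (rule ext) (rule trivial)
    then have C: "?C = {0}"
      using F.subspace_0[OF subspace] by blast
    have "same_dimension (fun_scale scl) (F.span {}) ?C"
      unfolding same_dimension_def C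
      by (intro exI[of _ "{}"]) (simp add: F.independent_empty)
    then show ?thesis
      unfolding maximal_lineable_def using sub by (intro conjI exI[of _ "F.span {}"]) auto
  next
    case True
    then obtain a :: 'x where a: "a \<noteq> 0" ..
    obtain K :: "nat \<Rightarrow> 'x set" where K: "incseq K" "\<And>n. Peano_space (top_of_set (K n))"
        "(\<Union>n. K n) = UNIV"
      using assms(2) unfolding sigma_Peano_space_def by auto
    have "\<exists>g. continuous_on {0..1::real} g \<and> g ` {0..1} = K n" for n
      using K(2)[of n] unfolding Peano_space_def
      by (auto simp: continuous_map_in_subtopology)
    then obtain g :: "nat \<Rightarrow> real \<Rightarrow> 'x" where
      g: "\<And>n. continuous_on {0..1} (g n)" "\<And>n. g n ` {0..1} = K n"
      by metis
    define \<phi> :: "nat set \<Rightarrow> real ^ 'm \<Rightarrow> 'x"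
      where "\<phi> S = (\<lambda>x. bump_series scl g (prefix_codes S) (norm x))" for S
    have comb: "(\<Sum>S\<in>T. fun_scale scl (c S) (\<phi> S)) \<in> ?S"
      if T: "finite T" "T \<noteq> {}" "\<And>S. S \<in> T \<Longrightarrow> c S \<noteq> 0" for T c
    proof -
      let ?f = "\<lambda>t. \<Sum>S\<in>T. scl (c S) (bump_series scl g (prefix_codes S) t)"
      have "continuous_on UNIV (\<lambda>t. scl (c S) (bump_series scl g (prefix_codes S) t))" for S
        using X.continuous_on_bump_series[OF g(1)]
        by (intro continuous_on_compose2[OF X.continuous_scl, of UNIV "\<lambda>t. (c S, _ t)", simplified]
            continuous_intros)
      then have "continuous_on UNIV ?f"
        by (intro continuous_on_sum)
      moreover have "\<exists>t \<ge> r. ?f t = b" for b r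
        by (rule X.sum_bump_series_attains_everything_far_out
            [OF K(1,3) g(2) infinite_prefix_codes finite_prefix_codes_Int T])
      ultimately have "(\<lambda>x :: real ^ 'm. ?f (norm x)) \<in> CS_infinity"
        by (rule CS_infinity_norm)
      moreover have "(\<Sum>S\<in>T. fun_scale scl (c S) (\<phi> S)) = (\<lambda>x. ?f (norm x))"
        by (simp add: fun_eq_iff sum_fun_apply fun_scale_def \<phi>_def)
      ultimately show ?thesis by simp
    qed
    have "0 \<notin> ?S"
    proof
      assume "0 \<in> ?S"
      then have "\<not> bounded ((0 :: real ^ 'm \<Rightarrow> 'x) -` {a})"
        unfolding CS_infinity_def by blast
      then show False
        using a by (simp add: vimage_def)
    qed
    note basis = F.independent_if_combinations_in[of \<phi> ?S, OF comb this]
    have "range \<phi> \<subseteq> ?C"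
    proof -
      have "?S \<union> {0} \<subseteq> ?C"
        using sub F.subspace_0[OF subspace] by simp
      then show ?thesis
        using F.span_superset basis(3) by (meson subset_trans)
    qed
    moreover have "?C \<lesssim> range \<phi>"
    proof -
      have "(UNIV :: 'x set) \<lesssim> (UNIV :: real set)"
        using sigma_Peano_space_lepoll_real[OF assms(2)] by simp
      also have "(UNIV :: real set) \<approx> (UNIV :: nat set set)"
        using nat_sets_eqpoll_reals by (rule eqpoll_sym)
      finally have "?C \<lesssim> (UNIV :: nat set set)"
        by (rule continuous_maps_lepoll_nat_sets
            [OF Hausdorff_space_sigma_Peano_group[OF assms(2)]])
      also have "(UNIV :: nat set set) \<approx> range \<phi>"
        using basis(1) by (meson eqpoll_sym inj_on_image_eqpoll_self)
      finally show ?thesis .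
    qed
    ultimately have "same_dimension (fun_scale scl) (F.span (range \<phi>)) ?C"
      using same_dimension_if_lepoll[OF vs subspace basis(2)] by blast
    then show ?thesis
      unfolding maximal_lineable_def using sub basis(3) F.subspace_span by blast
  qed
qed

end
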